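(* Every connected graph $G$ has the following properties: (1) $G$ is a prism $\gamma_{con}$-fixer, i.e. $\gamma_{con}(\mathrm{Id}\,G)=\gamma_{con}(G)$, if and only if $\gamma_{con}(G)=|V_G|$; (2) $G$ is a prism $\gamma_{con}$-doubler, i.e. $\gamma_{con}(\mathrm{Id}\,G)=2\gamma_{con}(G)$, if and only if $\gamma_{con}(G)\le\frac12|V_G|$.
   Context: Graphs are finite, simple, undirected and nonempty. For a graph $G$ with vertex set $V_G$ and a permutation $\pi$ of $V_G$, let $G'$ be a vertex-disjoint copy of $G$, with $v'$ the copy of $v$. The prism graph $\pi G$ has vertex set $V\cup V'$, where $V=V_G$ and $V'=V_{G'}$, and edge set $E_G\cup E_{G'}\cup\{u\,\pi(u)':u\in V_G\}$. $\mathrm{Id}\,G$ is the prism graph for $\pi$ the identity permutation. A set $A$ of vertices is dominating if every vertex of the graph is in $A$ or adjacent to a vertex of $A$. In a connected graph, $A$ is convex if for every $u,v\in A$ it contains all vertices of every shortest $u$--$v$ path of the graph. $\gamma_{con}$ denotes the minimum cardinality of a convex dominating set. A graph $G$ is a prism $\gamma_{con}$-fixer if $\gamma_{con}(\mathrm{Id}\,G)=\gamma_{con}(G)$, and a prism $\gamma_{con}$-doubler if $\gamma_{con}(\mathrm{Id}\,G)=2\gamma_{con}(G)$. *)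

theory Defs
  imports "Graph_Theory.Graph_Theory"
begin

(* A finite simple undirected graph is a "pair_graph" (finite, loop-free, symmetric arc set): the
   edge uv is the pair of arcs (u,v), (v,u).  The library predicate "connected" includes
   non-emptiness of the vertex set. *)

definition dominating_set :: "('a, 'b) pre_digraph \<Rightarrow> 'a set \<Rightarrow> bool" where
  "dominating_set G A \<longleftrightarrow>
     A \<subseteq> verts G \<and> (\<forall>v \<in> verts G. v \<in> A \<or> (\<exists>u \<in> A. u \<rightarrow>\<^bsub>G\<^esub> v))"

definition shortest_vpath :: "('a, 'b) pre_digraph \<Rightarrow> 'a \<Rightarrow> 'a \<Rightarrow> 'a vwalk \<Rightarrow> bool" where
  "shortest_vpath G u v p \<longleftrightarrow>
     vpath p G \<and> hd p = u \<and> last p = v \<and>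
     (\<forall>q. vpath q G \<and> hd q = u \<and> last q = v \<longrightarrow> vwalk_length p \<le> vwalk_length q)"

definition convex_set :: "('a, 'b) pre_digraph \<Rightarrow> 'a set \<Rightarrow> bool" where
  "convex_set G A \<longleftrightarrow>
     A \<subseteq> verts G \<and> (\<forall>u \<in> A. \<forall>v \<in> A. \<forall>p. shortest_vpath G u v p \<longrightarrow> set p \<subseteq> A)"

(* The minimum is over a finite set, nonempty because of verts_convex_dominating below. *)
definition gamma_con :: "('a, 'b) pre_digraph \<Rightarrow> nat" where
  "gamma_con G = Min (card ` {A. convex_set G A \<and> dominating_set G A})"

lemma verts_convex_dominating: "convex_set G (verts G)" "dominating_set G (verts G)"
  by (auto simp: convex_set_def dominating_set_def shortest_vpath_def vpath_def vwalk_def)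

(* Inl v is the vertex v itself and Inr v its copy v'. *)
definition prism :: "('a \<Rightarrow> 'a) \<Rightarrow> 'a pair_pre_digraph \<Rightarrow> ('a + 'a) pair_pre_digraph" where
  "prism \<pi> G = \<lparr> pverts = pverts G <+> pverts G,
     parcs = {(Inl u, Inl v) | u v. (u, v) \<in> parcs G}
           \<union> {(Inr u, Inr v) | u v. (u, v) \<in> parcs G}
           \<union> {(Inl u, Inr (\<pi> u)) | u. u \<in> pverts G}
           \<union> {(Inr (\<pi> u), Inl u) | u. u \<in> pverts G} \<rparr>"

lemma pair_graph_prism:
  assumes "pair_graph G" "bij_betw \<pi> (pverts G) (pverts G)"
  shows "pair_graph (prism \<pi> G)"
proof -
  interpret pair_graph G by fact
  have \<pi>: "\<pi> u \<in> pverts G" if "u \<in> pverts G" for u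
    using assms(2) that by (auto simp: bij_betw_def)
  have sub: "parcs (prism \<pi> G) \<subseteq> pverts (prism \<pi> G) \<times> pverts (prism \<pi> G)"
    by (auto simp: prism_def \<pi> dest: in_arcsD1 in_arcsD2)
  have fin: "finite (pverts (prism \<pi> G))"
    by (simp add: prism_def)
  show ?thesis
  proof
    show "finite (parcs (prism \<pi> G))"
      using sub fin by (meson finite_SigmaI finite_subset)
    show "symmetric (with_proj (prism \<pi> G))"
      by (auto simp: symmetric_def prism_def intro!: symI dest: arcs_symmetric)
    show "fst e \<noteq> snd e" if "e \<in> parcs (prism \<pi> G)" for e
      using that by (auto simp: prism_def dest: no_loops')
  qed (use sub fin in auto)
qed

abbreviation Id_prism :: "'a pair_pre_digraph \<Rightarrow> ('a + 'a) pair_pre_digraph" where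
  "Id_prism \<equiv> prism id"

definition prism_gamma_con_fixer :: "'a pair_pre_digraph \<Rightarrow> bool" where
  "prism_gamma_con_fixer G \<longleftrightarrow> gamma_con (with_proj (Id_prism G)) = gamma_con (with_proj G)"

definition prism_gamma_con_doubler :: "'a pair_pre_digraph \<Rightarrow> bool" where
  "prism_gamma_con_doubler G \<longleftrightarrow> gamma_con (with_proj (Id_prism G)) = 2 * gamma_con (with_proj G)"

end

theory Submission
  imports Defs
begin

text \<open>
  In the identity prism a shortest path between two vertices on the same side never leaves that
  side, and a shortest path between vertices on different sides switches sides exactly once;
  in both cases it projects onto a shortest path of \<open>G\<close>. A convex dominating set contained in
  one side has to be the whole side. A convex set meeting both sides is of the form \<open>A <+> A\<close>:
  from \<open>u\<close> on one side and \<open>v\<close> on the other, one may switch sides at once and then follow a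
  shortest \<open>u\<close>-\<open>v\<close> path. Hence
  \<open>gamma_con (Id_prism G) = min (card (pverts G)) (2 * gamma_con G)\<close>.
\<close>

section \<open>Shortest paths as shortest walks\<close>

lemma vwalk_to_vpath_length: "length (vwalk_to_vpath p) \<le> length p"
proof (induct p rule: vwalk_to_vpath_induct3)
  case (in_set x xs)
  then show ?case
    using length_dropWhile_le[of "\<lambda>y. y \<noteq> x" xs] by simp
qed auto

lemma vwalk_to_vpath_length_less: "\<not> distinct p \<Longrightarrow> length (vwalk_to_vpath p) < length p"
proof (induct p rule: vwalk_to_vpath_induct3)
  case (in_set x xs)
  then show ?case
    using vwalk_to_vpath_length[of "dropWhile (\<lambda>y. y \<noteq> x) xs"] length_dropWhile_le[of "\<lambda>y. y \<noteq> x" xs]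
    by simp
qed auto

lemma vwalk_arcs_map: "vwalk_arcs (map f p) = map (map_prod f f) (vwalk_arcs p)"
  by (induct p rule: vwalk_arcs.induct) auto

text \<open>Cutting a walk short at its repeated vertices keeps both ends and never lengthens it.
  With this form, lifted and projected walks can be compared without checking that they are
  \<open>distinct\<close>.\<close>

lemma shortest_vpath_iff_vwalk:
  "shortest_vpath G u v p \<longleftrightarrow> vwalk p G \<and> hd p = u \<and> last p = v \<and>
     (\<forall>q. vwalk q G \<and> hd q = u \<and> last q = v \<longrightarrow> length p \<le> length q)" (is "?L \<longleftrightarrow> ?R")
proof
  assume L: ?L
  have "length p \<le> length q" if q: "vwalk q G" "hd q = u" "last q = v" for q
  proof -
    have "vwalk_length p \<le> vwalk_length (vwalk_to_vpath q)"
      using L q vwalk_to_vpath_vpath[OF q(1)]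
      by (auto simp: shortest_vpath_def vwalk_to_vpath_hd vwalk_to_vpath_last)
    \<comment> \<open>\<open>vwalk_length\<close> counts arcs, so it is 0 for \<open>[]\<close> as
      well as for a single vertex; nonemptiness allows passing from arcs to
      \<open>length\<close>.\<close>
    moreover have "vwalk_to_vpath q \<noteq> []"
      using q(1) by (intro vwalk_to_vpath_nonempty) auto
    ultimately show ?thesis
      using vwalk_to_vpath_length[of q] by (cases "vwalk_to_vpath q") auto
  qed
  then show ?R using L by (auto simp: shortest_vpath_def)
next
  assume R: ?R
  \<comment> \<open>The shortened \<open>p\<close> competes with \<open>p\<close> itself, and it
    would win if \<open>p\<close> repeated a vertex.\<close>
  then have "length p \<le> length (vwalk_to_vpath p)"
    using vwalk_to_vpath_vpath[of p G] by (auto simp: vwalk_to_vpath_hd vwalk_to_vpath_last)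
  then have "distinct p"
    using vwalk_to_vpath_length_less[of p] by linarith
  then show ?L
    using R by (auto simp: shortest_vpath_def intro!: diff_le_mono)
qed

lemma shortest_vpath_exists:
  assumes "vwalk p G" "hd p = u" "last p = v"
  obtains q where "shortest_vpath G u v q"
  using ex_has_least_nat[of "\<lambda>q. vwalk q G \<and> hd q = u \<and> last q = v" p length] assms
  unfolding shortest_vpath_iff_vwalk by blast

section \<open>The minimum in \<open>gamma_con\<close>\<close>

lemma gamma_con_le:
  assumes "convex_set (with_proj G) A" "dominating_set (with_proj G) A" "pair_graph G"
  shows "gamma_con (with_proj G) \<le> card A"
proof -
  interpret pair_graph G by fact
  have "finite {A. convex_set (with_proj G) A \<and> dominating_set (with_proj G) A}"
    by (rule finite_subset[of _ "Pow (pverts G)"]) (auto simp: convex_set_def)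
  then show ?thesis
    unfolding gamma_con_def using assms by (intro Min_le) auto
qed

lemma gamma_con_attained:
  assumes "pair_graph G"
  obtains A where "convex_set (with_proj G) A" "dominating_set (with_proj G) A"
    "gamma_con (with_proj G) = card A"
proof -
  interpret pair_graph G by fact
  have "finite {A. convex_set (with_proj G) A \<and> dominating_set (with_proj G) A}"
    by (rule finite_subset[of _ "Pow (pverts G)"]) (auto simp: convex_set_def)
  then have "gamma_con (with_proj G) \<in>
      card ` {A. convex_set (with_proj G) A \<and> dominating_set (with_proj G) A}"
    unfolding gamma_con_def using verts_convex_dominating[of "with_proj G"]
    by (intro Min_in) auto
  then show thesis
    using that by auto
qed

section \<open>Coordinates on the identity prism: side and base vertex\<close>

fun base :: "'a + 'a \<Rightarrow> 'a" where
  "base (Inl v) = v"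
| "base (Inr v) = v"

text \<open>Naming the side by a Boolean, with \<open>True\<close> for the original graph, treats
  both sides of the prism in one argument: \<open>isl\<close> and \<open>base\<close> are the
  coordinates of a vertex.\<close>

definition copy :: "bool \<Rightarrow> 'a \<Rightarrow> 'a + 'a" where
  "copy b = (if b then Inl else Inr)"

text \<open>The change of side is placed at the very start, so that the copy of \<open>hd p\<close>
  on the target side lies on the lift; \<open>convex_set_both_sides\<close> rests on this.\<close>

definition lift_vwalk :: "bool \<Rightarrow> bool \<Rightarrow> 'a list \<Rightarrow> ('a + 'a) list" where
  "lift_vwalk b c p = (if b = c then [] else [copy b (hd p)]) @ map (copy c) p"

lemma base_copy [simp]: "base (copy b v) = v"
  and isl_copy [simp]: "isl (copy b v) = b"
  by (auto simp: copy_def)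

lemma copy_isl_base [simp]: "copy (isl x) (base x) = x"
  by (cases x) (auto simp: copy_def)

lemma copy_eq_iff: "copy b v = x \<longleftrightarrow> isl x = b \<and> base x = v"
  by (cases x) (auto simp: copy_def)

lemma mem_side_iff: "x \<in> copy b ` A \<longleftrightarrow> isl x = b \<and> base x \<in> A"
  by (cases x) (auto simp: copy_def)

lemma inj_copy: "inj_on (copy b) A"
  by (auto simp: copy_def inj_on_def)

lemma mem_Plus_base: "x \<in> A <+> A \<longleftrightarrow> base x \<in> A"
  by (cases x) auto

lemma pverts_Id_prism: "x \<in> pverts (Id_prism G) \<longleftrightarrow> base x \<in> pverts G"
  by (cases x) (auto simp: prism_def)

lemma parcs_Id_prism:
  "(x, y) \<in> parcs (Id_prism G) \<longleftrightarrow>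
     isl x = isl y \<and> (base x, base y) \<in> parcs G \<or>
     isl x \<noteq> isl y \<and> base x = base y \<and> base x \<in> pverts G"
  by (cases x; cases y) (auto simp: prism_def)

section \<open>Walks and shortest paths of the prism compared with those of \<open>G\<close>\<close>

context
  fixes G :: "'a pair_pre_digraph"
  assumes pair_graph: "pair_graph G"
begin

interpretation pair_graph G by (fact pair_graph)

text \<open>A step that changes sides repeats its base vertex and is contracted; every other step
  projects to an edge of \<open>G\<close>. A vertex off the starting side forces at least one
  contraction, hence the strict bound.\<close>

lemma vwalk_Id_prism_project:
  assumes "vwalk p (with_proj (Id_prism G))"
  shows "\<exists>q. vwalk q (with_proj G) \<and> hd q = base (hd p) \<and> last q = base (last p) \<and>
    set q = base ` set p \<and> length q \<le> length p \<and>
    ((\<exists>x \<in> set p. isl x \<noteq> isl (hd p)) \<longrightarrow> length q < length p)"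
  using assms
proof (induct p rule: vwalk_induct)
  case (Base u)
  then show ?case
    by (intro exI[of _ "[base u]"]) (auto simp: pverts_Id_prism)
next
  case (Cons u v es)
  then obtain q where q: "vwalk q (with_proj G)" "hd q = base v"
    "last q = base (last (v # es))" "set q = base ` set (v # es)" "length q \<le> length (v # es)"
    "(\<exists>x \<in> set (v # es). isl x \<noteq> isl v) \<longrightarrow> length q < length (v # es)"
    by auto
  then have "q \<noteq> []" by auto
  show ?case
  proof (cases "isl u = isl v")
    case True
    then have "(base u, hd q) \<in> parcs G"
      using Cons(1) q(2) by (simp add: parcs_Id_prism)
    then have "vwalk (base u # q) (with_proj G)"
      using q(1) by (auto intro!: vwalk_consI dest: in_arcsD1)
    then show ?thesis
      using q True \<open>q \<noteq> []\<close> by (intro exI[of _ "base u # q"]) auto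
  next
    \<comment> \<open>Here \<open>u\<close> and \<open>v\<close> are copies of each other, so
      \<open>q\<close> already starts at \<open>base u\<close> and is kept unchanged.\<close>
    case False
    then have "base u = base v"
      using Cons(1) by (simp add: parcs_Id_prism)
    then show ?thesis
      using q by (intro exI[of _ q]) auto
  qed
qed

lemma vwalk_map_copy:
  assumes "vwalk p (with_proj G)"
  shows "vwalk (map (copy b) p) (with_proj (Id_prism G))"
  using assms
  by (auto simp: vwalk_def vwalk_arcs_map pverts_Id_prism parcs_Id_prism subset_iff)

lemma lift_vwalk:
  assumes "vwalk p (with_proj G)"
  shows "vwalk (lift_vwalk b c p) (with_proj (Id_prism G))"
    and "hd (lift_vwalk b c p) = copy b (hd p)"
    and "last (lift_vwalk b c p) = copy c (last p)"
    and "length (lift_vwalk b c p) = length p + of_bool (b \<noteq> c)"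
proof -
  have "p \<noteq> []" "hd p \<in> pverts G"
    using assms by (auto simp: vwalk_def)
  then show "hd (lift_vwalk b c p) = copy b (hd p)"
    and "last (lift_vwalk b c p) = copy c (last p)"
    and "length (lift_vwalk b c p) = length p + of_bool (b \<noteq> c)"
    and "vwalk (lift_vwalk b c p) (with_proj (Id_prism G))"
    using vwalk_map_copy[OF assms]
    by (auto simp: lift_vwalk_def last_map hd_map pverts_Id_prism parcs_Id_prism intro!: vwalk_consI)
qed

text \<open>Any competitor projects to a walk of \<open>G\<close> that is no longer. If
  \<open>b \<noteq> c\<close>, its last vertex is off the starting side, and the strict bound pays
  for the extra vertex of the lift.\<close>

lemma shortest_vpath_lift:
  assumes "shortest_vpath (with_proj G) u v p"
  shows "shortest_vpath (with_proj (Id_prism G)) (copy b u) (copy c v) (lift_vwalk b c p)"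
proof -
  have p: "vwalk p (with_proj G)" "hd p = u" "last p = v"
    using assms by (auto simp: shortest_vpath_iff_vwalk)
  have "length (lift_vwalk b c p) \<le> length r"
    if r: "vwalk r (with_proj (Id_prism G))" "hd r = copy b u" "last r = copy c v" for r
  proof -
    from vwalk_Id_prism_project[OF r(1)] r(2,3) obtain q where
      q: "vwalk q (with_proj G)" "hd q = u" "last q = v" "length q \<le> length r"
        "(\<exists>x \<in> set r. isl x \<noteq> b) \<longrightarrow> length q < length r"
      by auto
    have "length p \<le> length q"
      using assms q by (auto simp: shortest_vpath_iff_vwalk)
    moreover have "last r \<in> set r"
      using r(1) by auto
    ultimately show ?thesis
      using q(4,5) r(3) lift_vwalk(4)[OF p(1), of b c] by (cases "b = c") force+
  qed
  then show ?thesis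
    using lift_vwalk[OF p(1), of b c] p by (auto simp: shortest_vpath_iff_vwalk)
qed

lemma shortest_vpath_project:
  assumes "shortest_vpath (with_proj (Id_prism G)) x y p"
  obtains q where "shortest_vpath (with_proj G) (base x) (base y) q"
    and "set q = base ` set p" and "isl x = isl y \<Longrightarrow> \<forall>z \<in> set p. isl z = isl x"
proof -
  have p: "vwalk p (with_proj (Id_prism G))" "hd p = x" "last p = y"
    using assms by (auto simp: shortest_vpath_iff_vwalk)
  from vwalk_Id_prism_project[OF p(1)] p(2,3) obtain q where
    q: "vwalk q (with_proj G)" "hd q = base x" "last q = base y" "set q = base ` set p"
      "length q \<le> length p" "(\<exists>z \<in> set p. isl z \<noteq> isl x) \<longrightarrow> length q < length p"
    by auto
  \<comment> \<open>The lift of \<open>r\<close> competes with \<open>p\<close>; it has one vertex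
    more than \<open>r\<close> exactly when the sides of \<open>x\<close> and \<open>y\<close>
    differ.\<close>
  have le: "length p \<le> length r + of_bool (isl x \<noteq> isl y)"
    if "vwalk r (with_proj G)" "hd r = base x" "last r = base y" for r
    using assms lift_vwalk[OF that(1), of "isl x" "isl y"] that(2,3)
    by (metis copy_isl_base shortest_vpath_iff_vwalk)
  have "y \<in> set p"
    using p by auto
  then have "length q + of_bool (isl x \<noteq> isl y) \<le> length p"
    using q(5,6) by (cases "isl x = isl y") force+
  then have "length q \<le> length r"
    if "vwalk r (with_proj G)" "hd r = base x" "last r = base y" for r
    using le[OF that] by linarith
  then have "shortest_vpath (with_proj G) (base x) (base y) q"
    using q(1-3) unfolding shortest_vpath_iff_vwalk by blast
  \<comment> \<open>For ends on one side, \<open>le\<close> applied to \<open>q\<close> itself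
    leaves no room for the loss that a change of side would cause.\<close>
  moreover have "\<forall>z \<in> set p. isl z = isl x" if "isl x = isl y"
    using le[OF q(1-3)] q(6) that by fastforce
  ultimately show thesis
    using q(4) that by blast
qed

section \<open>Convex and dominating sets of the prism\<close>

lemma convex_dominating_side:
  "convex_set (with_proj (Id_prism G)) (copy b ` pverts G)"
  "dominating_set (with_proj (Id_prism G)) (copy b ` pverts G)"
proof -
  show "convex_set (with_proj (Id_prism G)) (copy b ` pverts G)"
    unfolding convex_set_def
  proof (intro conjI ballI allI impI)
    show "copy b ` pverts G \<subseteq> verts (with_proj (Id_prism G))"
      by (auto simp: pverts_Id_prism)
  next
    fix x y p
    assume xy: "x \<in> copy b ` pverts G" "y \<in> copy b ` pverts G"
      and p: "shortest_vpath (with_proj (Id_prism G)) x y p"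
    then have isl: "\<forall>z \<in> set p. isl z = b"
      by (auto elim!: shortest_vpath_project)
    moreover have "set p \<subseteq> pverts (Id_prism G)"
      using p by (simp add: shortest_vpath_iff_vwalk vwalk_def)
    ultimately show "set p \<subseteq> copy b ` pverts G"
      by (auto simp: mem_side_iff pverts_Id_prism subset_iff)
  qed
  have "x \<in> copy b ` pverts G \<or> (\<exists>u \<in> copy b ` pverts G. (u, x) \<in> parcs (Id_prism G))"
    if "base x \<in> pverts G" for x
  proof (cases "isl x = b")
    case False
    then have "copy b (base x) \<in> copy b ` pverts G" "(copy b (base x), x) \<in> parcs (Id_prism G)"
      using that by (auto simp: parcs_Id_prism)
    then show ?thesis by blast
  qed (simp add: that mem_side_iff)
  then show "dominating_set (with_proj (Id_prism G)) (copy b ` pverts G)"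
    by (auto simp: dominating_set_def pverts_Id_prism)
qed

text \<open>\<open>A <+> A\<close> is the full preimage of \<open>A\<close> under
  \<open>base\<close>, and shortest paths both lift to and project onto shortest paths.\<close>

lemma convex_set_Plus_iff:
  "convex_set (with_proj (Id_prism G)) (A <+> A) \<longleftrightarrow> convex_set (with_proj G) A" (is "?L \<longleftrightarrow> ?R")
proof
  assume L: ?L
  have "set p \<subseteq> A" if "u \<in> A" "v \<in> A" "shortest_vpath (with_proj G) u v p" for u v p
  proof -
    have "set (lift_vwalk True True p) \<subseteq> A <+> A"
      using L that shortest_vpath_lift[OF that(3), of True True]
      by (simp only: convex_set_def) (metis base_copy mem_Plus_base)
    then show ?thesis
      by (auto simp: lift_vwalk_def mem_Plus_base subset_iff)
  qed
  moreover have "A \<subseteq> pverts G"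
    using L by (auto simp: convex_set_def prism_def)
  ultimately show ?R
    by (auto simp: convex_set_def)
next
  assume R: ?R
  have "set p \<subseteq> A <+> A"
    if "x \<in> A <+> A" "y \<in> A <+> A" "shortest_vpath (with_proj (Id_prism G)) x y p" for x y p
    using that(3)
  proof (rule shortest_vpath_project)
    fix q
    assume "shortest_vpath (with_proj G) (base x) (base y) q" "set q = base ` set p"
    then have "base ` set p \<subseteq> A"
      using R that(1,2) unfolding convex_set_def mem_Plus_base by metis
    then show ?thesis
      by (auto simp: mem_Plus_base)
  qed
  moreover have "A <+> A \<subseteq> pverts (Id_prism G)"
    using R by (auto simp: convex_set_def prism_def)
  ultimately show ?L
    by (auto simp: convex_set_def)
qed

text \<open>An edge between the two sides joins vertices with the same \<open>base\<close>, so it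
  dominates nothing that is not already in \<open>A <+> A\<close>.\<close>

lemma dominating_set_Plus_iff:
  "dominating_set (with_proj (Id_prism G)) (A <+> A) \<longleftrightarrow> dominating_set (with_proj G) A"
    (is "?L \<longleftrightarrow> ?R")
proof
  assume L: ?L
  then have sub: "A \<subseteq> pverts G"
    by (auto simp: dominating_set_def prism_def)
  have "v \<in> A \<or> (\<exists>u \<in> A. (u, v) \<in> parcs G)" if v: "v \<in> pverts G" for v
  proof -
    have "copy True v \<in> A <+> A \<or> (\<exists>x \<in> A <+> A. (x, copy True v) \<in> parcs (Id_prism G))"
      using L v by (simp add: dominating_set_def pverts_Id_prism)
    then show ?thesis
      by (auto simp: mem_Plus_base parcs_Id_prism)
  qed
  with sub show ?R
    by (auto simp: dominating_set_def)
next
  assume R: ?R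
  have "x \<in> A <+> A \<or> (\<exists>y \<in> A <+> A. (y, x) \<in> parcs (Id_prism G))" if "base x \<in> pverts G" for x
  proof (cases "base x \<in> A")
    case False
    moreover have "base x \<in> A \<or> (\<exists>u \<in> A. (u, base x) \<in> parcs G)"
      using R that by (simp add: dominating_set_def)
    ultimately obtain u where "u \<in> A" "(u, base x) \<in> parcs G"
      by blast
    then have "copy (isl x) u \<in> A <+> A" "(copy (isl x) u, x) \<in> parcs (Id_prism G)"
      by (auto simp: mem_Plus_base parcs_Id_prism)
    then show ?thesis
      by (metis (no_types))
  qed (simp add: mem_Plus_base)
  moreover have "A <+> A \<subseteq> pverts (Id_prism G)"
    using R by (auto simp: dominating_set_def prism_def)
  ultimately show ?L
    by (auto simp: dominating_set_def pverts_Id_prism)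
qed

text \<open>A vertex on the other side has only one neighbour on side \<open>b\<close>, namely its
  own copy, which must therefore belong to \<open>D\<close>.\<close>

lemma dominating_set_in_side:
  assumes "dominating_set (with_proj (Id_prism G)) D" "\<forall>x \<in> D. isl x = b"
  shows "D = copy b ` pverts G"
proof
  show "D \<subseteq> copy b ` pverts G"
  proof
    fix x assume "x \<in> D"
    then show "x \<in> copy b ` pverts G"
      using assms by (auto simp: dominating_set_def pverts_Id_prism mem_side_iff)
  qed
  show "copy b ` pverts G \<subseteq> D"
  proof
    fix x assume "x \<in> copy b ` pverts G"
    then obtain v where v: "x = copy b v" "v \<in> pverts G" by auto
    then have "copy (\<not> b) v \<in> D \<or> (\<exists>u \<in> D. (u, copy (\<not> b) v) \<in> parcs (Id_prism G))"
      using assms(1) by (auto simp: dominating_set_def pverts_Id_prism)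
    then obtain u where "u \<in> D" "(u, copy (\<not> b) v) \<in> parcs (Id_prism G)"
      using assms(2) by force
    then have "copy b v = u"
      using assms(2) by (auto simp: parcs_Id_prism copy_eq_iff)
    then show "x \<in> D"
      using \<open>u \<in> D\<close> v(1) by simp
  qed
qed

lemma convex_set_both_sides:
  assumes conn: "connected (with_proj G)"
    and conv: "convex_set (with_proj (Id_prism G)) D"
    and xy: "x \<in> D" "y \<in> D" "isl x \<noteq> isl y"
  shows "D = base ` D <+> base ` D"
proof -
  \<comment> \<open>Take \<open>w\<close> in \<open>D\<close> on the side opposite to
    \<open>z\<close>: the copy of \<open>z\<close> lies on a lifted shortest path from
    \<open>z\<close> to \<open>w\<close>, hence in \<open>D\<close> by convexity.\<close>
  have switch: "copy (\<not> isl z) (base z) \<in> D" if z: "z \<in> D" for z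
  proof -
    obtain w where w: "w \<in> D" "isl w = (\<not> isl z)"
      using xy by metis
    have "base z \<in> pverts G" "base w \<in> pverts G"
      using conv z w(1) by (auto simp: convex_set_def pverts_Id_prism)
    \<comment> \<open>\<open>connected\<close> disregards the direction of arcs; symmetry of the arc
      set turns it into reachability.\<close>
    then have "base z \<rightarrow>\<^sup>*\<^bsub>with_proj G\<^esub> base w"
      using symmetric_connected_imp_strongly_connected[OF sym_arcs conn]
      by (auto simp: strongly_connected_def)
    then obtain p where p: "shortest_vpath (with_proj G) (base z) (base w) p"
      by (auto simp: reachable_vwalk_conv elim: shortest_vpath_exists)
    then have "p \<noteq> []" "hd p = base z"
      by (auto simp: shortest_vpath_iff_vwalk)
    then have "base z \<in> set p"
      by (metis hd_in_set)
    then have "copy (isl w) (base z) \<in> set (lift_vwalk (isl z) (isl w) p)"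
      by (simp add: lift_vwalk_def)
    moreover have "set (lift_vwalk (isl z) (isl w) p) \<subseteq> D"
      using shortest_vpath_lift[OF p, of "isl z" "isl w"] conv z w(1)
      by (simp add: convex_set_def)
    ultimately show ?thesis
      using w(2) by auto
  qed
  have "z \<in> D" if "base z \<in> base ` D" for z
  proof -
    from that obtain w where "w \<in> D" "base z = base w" by auto
    then show ?thesis
      using switch[of w] copy_eq_iff[of "\<not> isl w" "base w" z] copy_eq_iff[of "isl w" "base w" z]
      by (cases "isl z = isl w") auto
  qed
  then show ?thesis
    unfolding set_eq_iff mem_Plus_base by blast
qed

section \<open>The value of \<open>gamma_con\<close> on the identity prism\<close>

theorem gamma_con_Id_prism:
  assumes conn: "connected (with_proj G)"
  shows "gamma_con (with_proj (Id_prism G)) = min (card (pverts G)) (2 * gamma_con (with_proj G))"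
proof (rule antisym)
  have prism: "pair_graph (Id_prism G)"
    by (simp add: pair_graph_prism[OF pair_graph])
  have card_side: "card (copy b ` pverts G) = card (pverts G)" for b
    by (simp add: card_image inj_copy)
  have card_Plus: "card (A <+> A) = 2 * card A" if "convex_set (with_proj G) A" for A
    using that finite_subset[of A "pverts G"] by (simp add: convex_set_def card_Plus)
  obtain A where A: "convex_set (with_proj G) A" "dominating_set (with_proj G) A"
    "gamma_con (with_proj G) = card A"
    using gamma_con_attained[OF pair_graph] .
  \<comment> \<open>The two bounds come from one whole side and from \<open>A <+> A\<close> with
    \<open>A\<close> optimal in \<open>G\<close>.\<close>
  show "gamma_con (with_proj (Id_prism G)) \<le> min (card (pverts G)) (2 * gamma_con (with_proj G))"
    using gamma_con_le[OF convex_dominating_side prism, of True]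
      gamma_con_le[of "Id_prism G" "A <+> A"] A prism
    by (simp add: card_side card_Plus convex_set_Plus_iff dominating_set_Plus_iff)
  obtain D where D: "convex_set (with_proj (Id_prism G)) D"
    "dominating_set (with_proj (Id_prism G)) D" "gamma_con (with_proj (Id_prism G)) = card D"
    using gamma_con_attained[OF prism] .
  show "min (card (pverts G)) (2 * gamma_con (with_proj G)) \<le> gamma_con (with_proj (Id_prism G))"
  proof (cases "\<exists>b. \<forall>x \<in> D. isl x = b")
    case True
    then show ?thesis
      using dominating_set_in_side[OF D(2)] D(3) card_side by (metis min.cobounded1)
  next
    case False
    then obtain x y where xy: "x \<in> D" "y \<in> D" "isl x \<noteq> isl y" by metis
    let ?B = "base ` D"
    have eq: "D = ?B <+> ?B"
      using convex_set_both_sides[OF conn D(1) xy] .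
    then have B: "convex_set (with_proj G) ?B" "dominating_set (with_proj G) ?B"
      using D convex_set_Plus_iff dominating_set_Plus_iff by metis+
    then have "gamma_con (with_proj G) \<le> card ?B"
      using gamma_con_le pair_graph by blast
    moreover have "card D = 2 * card ?B"
      using card_Plus[OF B(1)] eq by metis
    ultimately show ?thesis
      using D(3) by simp
  qed
qed

lemma gamma_con_le_card: "gamma_con (with_proj G) \<le> card (pverts G)"
  using gamma_con_le[OF _ _ pair_graph] verts_convex_dominating[of "with_proj G"] by simp

text \<open>Excludes the value 0, for which \<open>min n (2 * k) = k\<close> would hold whatever
  \<open>n\<close> is.\<close>

lemma gamma_con_pos:
  assumes "pverts G \<noteq> {}"
  shows "0 < gamma_con (with_proj G)"
proof -
  obtain A where A: "dominating_set (with_proj G) A" "gamma_con (with_proj G) = card A"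
    using gamma_con_attained[OF pair_graph] by blast
  then have "A \<noteq> {}" "finite A"
    using assms finite_subset[of A "pverts G"] by (auto simp: dominating_set_def)
  then show ?thesis
    using A(2) by (simp add: card_gt_0_iff)
qed

end

theorem corollary16:
  fixes G :: "'a pair_pre_digraph"
  assumes "pair_graph G" and "connected (with_proj G)"
  shows "(prism_gamma_con_fixer G \<longleftrightarrow> gamma_con (with_proj G) = card (pverts G)) \<and>
         (prism_gamma_con_doubler G \<longleftrightarrow>
            real (gamma_con (with_proj G)) \<le> 1 / 2 * real (card (pverts G)))"
proof -
  have "pverts G \<noteq> {}"
    using assms(2) by (auto simp: connected_conv)
  then have "0 < gamma_con (with_proj G)"
    by (rule gamma_con_pos[OF assms(1)])
  \<comment> \<open>With \<open>n\<close> vertices and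
    \<open>k = gamma_con (with_proj G) > 0\<close>, \<open>2 * k\<close> exceeds \<open>k\<close>,
    so \<open>min n (2 * k) = k\<close> forces \<open>n = k\<close>; and
    \<open>min n (2 * k) = 2 * k\<close> says \<open>2 * k \<le> n\<close>.\<close>
  then show ?thesis
    using gamma_con_le_card[OF assms(1)]
    unfolding prism_gamma_con_fixer_def prism_gamma_con_doubler_def
      gamma_con_Id_prism[OF assms]
    by linarith
qed

end
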